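(* Let $X$ be a topological space such that its Smyth power space $P^s(X)$ is a cut space. Then $X$ is a cut space.
   Context: For a topological space $X$, the specialization preorder is $x\le y$ iff $x\in\mathrm{cl}\{y\}$; all order-theoretic notions in $X$ refer to it. For $A\subseteq X$, $A^{\uparrow}$ and $A^{\downarrow}$ denote the sets of all upper, respectively lower, bounds of $A$ in $X$, and $A^{\delta}=(A^{\uparrow})^{\downarrow}$ is the cut closure of $A$. Directed sets are nonempty. $X$ is a cut space if $\mathrm{cl}\,D=D^{\delta}$ for every directed subset $D$ of $X$. The Smyth power space $P^s(X)$ is the set $K(X)$ of nonempty compact saturated subsets of $X$ (saturated = intersection of open sets, equivalently an upper set), with the upper Vietoris topology generated by the sets $\Box U=\{K\in K(X):K\subseteq U\}$, $U$ open in $X$; its specialization order is reverse inclusion. *)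

theory Defs
  imports "HOL-Analysis.Analysis"
begin

definition spec_le :: "'a topology \<Rightarrow> 'a \<Rightarrow> 'a \<Rightarrow> bool" where
  "spec_le X x y \<longleftrightarrow> x \<in> topspace X \<and> y \<in> topspace X \<and> x \<in> X closure_of {y}"

definition upper_bounds :: "'a topology \<Rightarrow> 'a set \<Rightarrow> 'a set" where
  "upper_bounds X A = {u \<in> topspace X. \<forall>a\<in>A. spec_le X a u}"

definition lower_bounds :: "'a topology \<Rightarrow> 'a set \<Rightarrow> 'a set" where
  "lower_bounds X A = {l \<in> topspace X. \<forall>a\<in>A. spec_le X l a}"

definition cut_closure :: "'a topology \<Rightarrow> 'a set \<Rightarrow> 'a set" where
  "cut_closure X A = lower_bounds X (upper_bounds X A)"

definition directed_in :: "'a topology \<Rightarrow> 'a set \<Rightarrow> bool" where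
  "directed_in X D \<longleftrightarrow> D \<subseteq> topspace X \<and> D \<noteq> {} \<and>
     (\<forall>x\<in>D. \<forall>y\<in>D. \<exists>z\<in>D. spec_le X x z \<and> spec_le X y z)"

definition cut_space :: "'a topology \<Rightarrow> bool" where
  "cut_space X \<longleftrightarrow> (\<forall>D. directed_in X D \<longrightarrow> X closure_of D = cut_closure X D)"

(* Intersecting with the whole space makes the empty intersection topspace X rather than UNIV. *)
definition saturated_in :: "'a topology \<Rightarrow> 'a set \<Rightarrow> bool" where
  "saturated_in X K \<longleftrightarrow> (\<exists>\<U>. (\<forall>U\<in>\<U>. openin X U) \<and> K = topspace X \<inter> \<Inter>\<U>)"

lemma saturated_in_iff_upper:
  "saturated_in X K \<longleftrightarrow> K \<subseteq> topspace X \<and> (\<forall>x y. x \<in> K \<and> spec_le X x y \<longrightarrow> y \<in> K)"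
proof
  assume "saturated_in X K"
  then obtain \<U> where U: "\<forall>U\<in>\<U>. openin X U" and K: "K = topspace X \<inter> \<Inter>\<U>"
    unfolding saturated_in_def by blast
  have "y \<in> K" if "x \<in> K" "spec_le X x y" for x y
    using that U unfolding K spec_le_def in_closure_of by blast
  with K show "K \<subseteq> topspace X \<and> (\<forall>x y. x \<in> K \<and> spec_le X x y \<longrightarrow> y \<in> K)" by blast
next
  assume K: "K \<subseteq> topspace X \<and> (\<forall>x y. x \<in> K \<and> spec_le X x y \<longrightarrow> y \<in> K)"
  have in_K: "y \<in> K" if y: "y \<in> topspace X" "\<forall>U. openin X U \<and> K \<subseteq> U \<longrightarrow> y \<in> U" for y
  proof (rule ccontr)
    assume "y \<notin> K"
    have "openin X (topspace X - X closure_of {y})" by (simp add: openin_diff)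
    moreover have "K \<subseteq> topspace X - X closure_of {y}"
      using K y(1) \<open>y \<notin> K\<close> unfolding spec_le_def by blast
    ultimately have "y \<notin> X closure_of {y}" using y(2) by blast
    then show False using y(1) by (simp add: in_closure_of)
  qed
  have "K = topspace X \<inter> \<Inter>{U. openin X U \<and> K \<subseteq> U}" (is "K = ?R")
  proof (intro equalityI subsetI)
    fix y assume "y \<in> ?R"
    then show "y \<in> K" using in_K by simp
  qed (use K in auto)
  then show "saturated_in X K"
    unfolding saturated_in_def by (intro exI[of _ "{U. openin X U \<and> K \<subseteq> U}"]) simp
qed

definition compact_saturated :: "'a topology \<Rightarrow> 'a set set" where
  "compact_saturated X = {K. K \<noteq> {} \<and> compactin X K \<and> saturated_in X K}"

definition smyth_box :: "'a topology \<Rightarrow> 'a set \<Rightarrow> 'a set set" where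
  "smyth_box X U = {K \<in> compact_saturated X. K \<subseteq> U}"

definition smyth_power :: "'a topology \<Rightarrow> 'a set topology" where
  "smyth_power X = topology_generated_by {smyth_box X U | U. openin X U}"

lemma topspace_smyth_power: "topspace (smyth_power X) = compact_saturated X"
proof -
  have "compact_saturated X = smyth_box X (topspace X)"
    by (auto simp: smyth_box_def compact_saturated_def dest: compactin_subset_topspace)
  then have "compact_saturated X \<in> {smyth_box X U | U. openin X U}" by blast
  then show ?thesis
    unfolding smyth_power_def topology_generated_by_topspace by (auto simp: smyth_box_def)
qed

lemma spec_le_smyth_power:
  "spec_le (smyth_power X) K L \<longleftrightarrow> K \<in> compact_saturated X \<and> L \<in> compact_saturated X \<and> L \<subseteq> K"
proof
  assume a: "spec_le (smyth_power X) K L"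
  then have KL: "K \<in> compact_saturated X" "L \<in> compact_saturated X"
    unfolding spec_le_def topspace_smyth_power by auto
  have box: "L \<subseteq> U" if "openin X U" "K \<subseteq> U" for U
  proof -
    have "openin (smyth_power X) (smyth_box X U)"
      unfolding smyth_power_def by (rule topology_generated_by_Basis) (use that in blast)
    moreover have "K \<in> smyth_box X U" using KL that by (simp add: smyth_box_def)
    ultimately have "L \<in> smyth_box X U"
      using a unfolding spec_le_def in_closure_of by blast
    then show ?thesis by (simp add: smyth_box_def)
  qed
  obtain \<U> where "\<forall>U\<in>\<U>. openin X U" "K = topspace X \<inter> \<Inter>\<U>"
    using KL(1) unfolding compact_saturated_def saturated_in_def by blast
  moreover have "L \<subseteq> topspace X"
    using KL(2) by (simp add: compact_saturated_def compactin_subset_topspace)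
  ultimately have "L \<subseteq> K" using box by (metis Inf_lower Int_subset_iff Inf_greatest le_infI2)
  with KL show "K \<in> compact_saturated X \<and> L \<in> compact_saturated X \<and> L \<subseteq> K" by blast
next
  assume KL: "K \<in> compact_saturated X \<and> L \<in> compact_saturated X \<and> L \<subseteq> K"
  have "K \<in> W \<longrightarrow> L \<in> W"
    if "generate_topology_on {smyth_box X U | U. openin X U} W" for W
    using that
  proof induction
    case (Basis W)
    then show ?case using KL by (auto simp: smyth_box_def)
  qed auto
  then have "K \<in> W \<longrightarrow> L \<in> W" if "openin (smyth_power X) W" for W
    using that unfolding smyth_power_def openin_topology_generated_by_iff by blast
  then show "spec_le (smyth_power X) K L"
    using KL by (simp add: spec_le_def topspace_smyth_power in_closure_of)
qed

end

theory Submission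
  imports Defs
begin

text \<open>The map sending a point \<open>x\<close> to its principal filter \<open>\<up>x\<close> embeds \<open>X\<close> into its Smyth power space.
  For directed \<open>D\<close>, an upper bound of \<open>{\<up>d | d \<in> D}\<close> is a compact saturated set of upper bounds
  of \<open>D\<close>, hence is contained in \<open>\<up>x\<close> whenever \<open>x\<close> lies in the cut closure of \<open>D\<close>. So \<open>\<up>x\<close> lies in the
  cut closure of \<open>{\<up>d | d \<in> D}\<close>, which is its closure by assumption, and testing this against the
  sets \<open>\<box>U\<close> gives that \<open>x\<close> is in the closure of \<open>D\<close>.\<close>

definition up_set :: "'a topology \<Rightarrow> 'a \<Rightarrow> 'a set" where
  "up_set X x = {y. spec_le X x y}"

lemma spec_le_iff_openin:
  "spec_le X x y \<longleftrightarrow> x \<in> topspace X \<and> y \<in> topspace X \<and> (\<forall>U. openin X U \<and> x \<in> U \<longrightarrow> y \<in> U)"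
  by (auto simp: spec_le_def in_closure_of)

lemma spec_le_refl: "x \<in> topspace X \<Longrightarrow> spec_le X x x"
  by (simp add: spec_le_iff_openin)

lemma spec_le_trans: "spec_le X x y \<Longrightarrow> spec_le X y z \<Longrightarrow> spec_le X x z"
  by (simp add: spec_le_iff_openin)

lemma up_set_subset_openin: "openin X U \<Longrightarrow> x \<in> U \<Longrightarrow> up_set X x \<subseteq> U"
  by (auto simp: up_set_def spec_le_iff_openin)

lemma up_set_antimono: "spec_le X x y \<Longrightarrow> up_set X y \<subseteq> up_set X x"
  by (auto simp: up_set_def intro: spec_le_trans)

text \<open>Every open set around \<open>x\<close> contains all of \<open>up_set X x\<close>, so
  compactness needs only the one member of a cover that contains \<open>x\<close>. Saturation is
  transitivity of the preorder.\<close>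

lemma up_set_in_compact_saturated:
  assumes x: "x \<in> topspace X"
  shows "up_set X x \<in> compact_saturated X"
proof -
  have self: "x \<in> up_set X x" using x by (simp add: up_set_def spec_le_refl)
  have sub: "up_set X x \<subseteq> topspace X" by (auto simp: up_set_def spec_le_def)
  have "\<exists>\<F>. finite \<F> \<and> \<F> \<subseteq> \<U> \<and> up_set X x \<subseteq> \<Union>\<F>"
    if cover: "\<forall>U\<in>\<U>. openin X U" "up_set X x \<subseteq> \<Union>\<U>" for \<U>
  proof -
    obtain U where "U \<in> \<U>" "x \<in> U" using cover(2) self by blast
    then show ?thesis
      using cover(1) up_set_subset_openin[of X U x] by (intro exI[of _ "{U}"]) auto
  qed
  then have "compactin X (up_set X x)" using sub by (auto simp: compactin_def)
  moreover have "saturated_in X (up_set X x)"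
    unfolding saturated_in_iff_upper using sub by (auto simp: up_set_def intro: spec_le_trans)
  ultimately show ?thesis using self by (auto simp: compact_saturated_def)
qed

text \<open>An upper bound \<open>u\<close> of \<open>D\<close> puts \<open>D\<close> inside the
  closed set \<open>X closure_of {u}\<close>, which then also contains the closure of
  \<open>D\<close>.\<close>

lemma closure_of_subset_cut_closure:
  assumes "D \<subseteq> topspace X"
  shows "X closure_of D \<subseteq> cut_closure X D"
proof
  fix x assume x: "x \<in> X closure_of D"
  have "spec_le X x u" if u: "u \<in> upper_bounds X D" for u
  proof -
    have "D \<subseteq> X closure_of {u}" using u by (auto simp: upper_bounds_def spec_le_def)
    then have "X closure_of D \<subseteq> X closure_of {u}" by (simp add: closure_of_minimal)
    then show ?thesis
      using x u by (auto simp: spec_le_def upper_bounds_def in_closure_of)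
  qed
  then show "x \<in> cut_closure X D"
    using x by (auto simp: cut_closure_def lower_bounds_def in_closure_of)
qed

text \<open>Passing to principal filters reverses the order into inclusion, and the Smyth order is
  reverse inclusion, so the map is monotone and preserves directedness.\<close>

lemma spec_le_up_set: "spec_le X x y \<Longrightarrow> spec_le (smyth_power X) (up_set X x) (up_set X y)"
  unfolding spec_le_smyth_power
  using up_set_antimono up_set_in_compact_saturated by (metis spec_le_def)

lemma directed_in_image_up_set:
  assumes "directed_in X D"
  shows "directed_in (smyth_power X) (up_set X ` D)"
proof -
  have D: "D \<subseteq> topspace X" "D \<noteq> {}" using assms by (auto simp: directed_in_def)
  have "up_set X ` D \<subseteq> topspace (smyth_power X)"
    using D(1) by (auto simp: topspace_smyth_power intro!: up_set_in_compact_saturated)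
  moreover have "\<exists>c\<in>D. spec_le (smyth_power X) (up_set X a) (up_set X c)
      \<and> spec_le (smyth_power X) (up_set X b) (up_set X c)"
    if "a \<in> D" "b \<in> D" for a b
  proof -
    obtain c where "c \<in> D" "spec_le X a c" "spec_le X b c"
      using assms \<open>a \<in> D\<close> \<open>b \<in> D\<close> unfolding directed_in_def by blast
    then show ?thesis by (blast intro: spec_le_up_set)
  qed
  ultimately show ?thesis
    using D(2) unfolding directed_in_def by simp
qed

lemma up_set_in_cut_closure:
  assumes D: "D \<subseteq> topspace X" and x: "x \<in> cut_closure X D"
  shows "up_set X x \<in> cut_closure (smyth_power X) (up_set X ` D)"
proof -
  have x_top: "x \<in> topspace X" using x by (simp add: cut_closure_def lower_bounds_def)
  have "K \<subseteq> up_set X x" if K: "K \<in> upper_bounds (smyth_power X) (up_set X ` D)" for K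
  proof
    fix y assume "y \<in> K"
    moreover have "K \<subseteq> topspace X"
      using K by (auto simp: upper_bounds_def topspace_smyth_power compact_saturated_def
          dest: compactin_subset_topspace)
    \<comment> \<open>As an upper bound in the Smyth order, \<open>K\<close> is contained in
      \<open>up_set X d\<close> for every \<open>d\<close> in \<open>D\<close>, so each such
      \<open>d\<close> lies below \<open>y\<close>.\<close>
    ultimately have "y \<in> upper_bounds X D"
      using K by (auto simp: upper_bounds_def spec_le_smyth_power up_set_def)
    then show "y \<in> up_set X x"
      using x by (simp add: cut_closure_def lower_bounds_def up_set_def)
  qed
  then show ?thesis
    using up_set_in_compact_saturated[OF x_top]
    by (auto simp: cut_closure_def lower_bounds_def spec_le_smyth_power topspace_smyth_power
        upper_bounds_def)
qed

lemma openin_smyth_box: "openin X U \<Longrightarrow> openin (smyth_power X) (smyth_box X U)"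
  unfolding smyth_power_def by (rule topology_generated_by_Basis) blast

text \<open>For an open \<open>U\<close> around \<open>x\<close>, \<open>smyth_box X U\<close> is a
  neighbourhood of \<open>up_set X x\<close> and so contains some \<open>up_set X d\<close> with
  \<open>d\<close> in \<open>D\<close>. Since \<open>d\<close> belongs to \<open>up_set X d\<close>,
  it lies in \<open>U\<close>.\<close>

lemma in_closure_of_if_up_set:
  assumes D: "D \<subseteq> topspace X" and x: "x \<in> topspace X"
    and cl: "up_set X x \<in> smyth_power X closure_of (up_set X ` D)"
  shows "x \<in> X closure_of D"
proof -
  have "\<exists>d\<in>D. d \<in> U" if U: "openin X U" "x \<in> U" for U
  proof -
    have "up_set X x \<in> smyth_box X U"
      using up_set_subset_openin[OF U] up_set_in_compact_saturated[OF x]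
      by (simp add: smyth_box_def)
    then obtain d where "d \<in> D" "up_set X d \<in> smyth_box X U"
      using cl openin_smyth_box[OF U(1)] unfolding in_closure_of by blast
    then show ?thesis
      using D by (auto simp: smyth_box_def up_set_def intro: spec_le_refl)
  qed
  then show ?thesis using x by (auto simp: in_closure_of)
qed

theorem theorem3p14:
  fixes X :: "'a topology"
  assumes "cut_space (smyth_power X)"
  shows "cut_space X"
  unfolding cut_space_def
proof (intro allI impI equalityI)
  fix D assume dir: "directed_in X D"
  then have D: "D \<subseteq> topspace X" by (simp add: directed_in_def)
  show "X closure_of D \<subseteq> cut_closure X D" using D by (rule closure_of_subset_cut_closure)
  show "cut_closure X D \<subseteq> X closure_of D"
  proof
    fix x assume x: "x \<in> cut_closure X D"
    \<comment> \<open>The cut space assumption, applied to the directed image of \<open>D\<close>,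
      replaces its cut closure by its closure.\<close>
    have "up_set X x \<in> smyth_power X closure_of (up_set X ` D)"
      using up_set_in_cut_closure[OF D x] assms directed_in_image_up_set[OF dir]
      by (simp add: cut_space_def)
    moreover have "x \<in> topspace X" using x by (simp add: cut_closure_def lower_bounds_def)
    ultimately show "x \<in> X closure_of D" using D by (blast intro: in_closure_of_if_up_set)
  qed
qed

end
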